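(* For all integers $0\le r\le n$, the only points of $\mathbb{Z}^{\overline{\mathcal{S}}_{r,n}}$ lying in $\overline{\Omega}_{r,n}$ are the vertices of $\overline{\Omega}_{r,n}$.
   Context: For integers $0\le r\le n$, $\overline{\mathcal{M}}_{r,n}$ is the set of matroids with ground set $[n]=\{1,\dots,n\}$ and rank $r$. The base polytope $\mathscr{P}(\mathsf{M})\subseteq\mathbb{R}^n$ is the convex hull of the $0/1$ indicator vectors of the bases of $\mathsf{M}$; $\mathbf{1}_X$ is the indicator function of $X\subseteq\mathbb{R}^n$. A Schubert matroid is a matroid whose lattice of cyclic flats is a chain; $\overline{\mathcal{S}}_{r,n}\subseteq\overline{\mathcal{M}}_{r,n}$ is the set of Schubert matroids. For each $\mathsf{M}\in\overline{\mathcal{M}}_{r,n}$ there are unique integers $a_{\mathsf{S}}(\mathsf{M})$ ($\mathsf{S}\in\overline{\mathcal{S}}_{r,n}$) with $\mathbf{1}_{\mathscr{P}(\mathsf{M})}=\sum_{\mathsf{S}}a_{\mathsf{S}}(\mathsf{M})\mathbf{1}_{\mathscr{P}(\mathsf{S})}$; let $\overline{p}_{\mathsf{M}}=(a_{\mathsf{S}}(\mathsf{M}))_{\mathsf{S}}\in\mathbb{Z}^{\overline{\mathcal{S}}_{r,n}}$ and $\overline{\Omega}_{r,n}=\operatorname{conv}\{\overline{p}_{\mathsf{M}}:\mathsf{M}\in\overline{\mathcal{M}}_{r,n}\}\subseteq\mathbb{R}^{\overline{\mathcal{S}}_{r,n}}$. *)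

theory Defs
  imports "HOL-Analysis.Analysis" "HOL-Analysis.Finite_Function_Topology"
begin

text \<open>
  A matroid on a ground set \<open>E\<close> is represented by its family of bases \<open>\<B>\<close>. As \<open>\<B>\<close> does not
  determine \<open>E\<close> (there may be loops), notions that depend on the ground set take \<open>E\<close> as an argument.
\<close>

definition matroid :: "'a set \<Rightarrow> 'a set set \<Rightarrow> bool"
  where "matroid E \<B> \<longleftrightarrow>
    finite E \<and> \<B> \<noteq> {} \<and> (\<forall>B\<in>\<B>. B \<subseteq> E) \<and>
    (\<forall>B\<^sub>1\<in>\<B>. \<forall>B\<^sub>2\<in>\<B>. \<forall>x\<in>B\<^sub>1 - B\<^sub>2. \<exists>y\<in>B\<^sub>2 - B\<^sub>1. insert y (B\<^sub>1 - {x}) \<in> \<B>)"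

definition mat_rank :: "'a set set \<Rightarrow> 'a set \<Rightarrow> nat"
  where "mat_rank \<B> X = Max ((\<lambda>B. card (X \<inter> B)) ` \<B>)"

definition mat_indep :: "'a set set \<Rightarrow> 'a set \<Rightarrow> bool"
  where "mat_indep \<B> X \<longleftrightarrow> (\<exists>B\<in>\<B>. X \<subseteq> B)"

definition mat_circuit :: "'a set \<Rightarrow> 'a set set \<Rightarrow> 'a set \<Rightarrow> bool"
  where "mat_circuit E \<B> C \<longleftrightarrow> C \<subseteq> E \<and> \<not> mat_indep \<B> C \<and> (\<forall>X. X \<subset> C \<longrightarrow> mat_indep \<B> X)"

definition mat_flat :: "'a set \<Rightarrow> 'a set set \<Rightarrow> 'a set \<Rightarrow> bool"
  where "mat_flat E \<B> F \<longleftrightarrow> F \<subseteq> E \<and> (\<forall>e\<in>E - F. mat_rank \<B> F < mat_rank \<B> (insert e F))"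

definition mat_cyclic :: "'a set \<Rightarrow> 'a set set \<Rightarrow> 'a set \<Rightarrow> bool"
  where "mat_cyclic E \<B> X \<longleftrightarrow> (\<exists>\<C>. \<C> \<subseteq> {C. mat_circuit E \<B> C} \<and> X = \<Union>\<C>)"

definition cyclic_flats :: "'a set \<Rightarrow> 'a set set \<Rightarrow> 'a set set"
  where "cyclic_flats E \<B> = {F. mat_flat E \<B> F \<and> mat_cyclic E \<B> F}"

definition matroids :: "nat \<Rightarrow> nat \<Rightarrow> nat set set set"
  where "matroids r n = {\<B>. matroid {1..n} \<B> \<and> mat_rank \<B> {1..n} = r}"

definition schubert_matroids :: "nat \<Rightarrow> nat \<Rightarrow> nat set set set"
  where "schubert_matroids r n = {\<B> \<in> matroids r n. chain\<^sub>\<subseteq> (cyclic_flats {1..n} \<B>)}"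

text \<open>
  For a finite set \<open>I\<close>, the space \<open>\<real>\<^sup>I\<close> is realised as the finitely supported functions whose
  support lies in \<open>I\<close>. They form a linear subspace, so convex hulls and extreme points may be
  computed in the ambient type. In particular \<open>\<real>\<^sup>n\<close> is \<open>supported_on {1..n}\<close>.
\<close>

definition supported_on :: "'i set \<Rightarrow> ('i \<Rightarrow>\<^sub>0 real) set"
  where "supported_on I = {x. Poly_Mapping.keys x \<subseteq> I}"

definition integer_points :: "'i set \<Rightarrow> ('i \<Rightarrow>\<^sub>0 real) set"
  where "integer_points I = {x \<in> supported_on I. \<forall>i\<in>I. Poly_Mapping.lookup x i \<in> \<int>}"

definition vec_on :: "'i set \<Rightarrow> ('i \<Rightarrow> real) \<Rightarrow> ('i \<Rightarrow>\<^sub>0 real)"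
  where "vec_on I f = (\<Sum>i\<in>I. Poly_Mapping.single i (f i))"

lemma lookup_vec_on:
  assumes "finite I"
  shows "Poly_Mapping.lookup (vec_on I f) i = (if i \<in> I then f i else 0)"
  using assms by (simp add: vec_on_def lookup_sum lookup_single when_def)

definition base_polytope :: "nat set set \<Rightarrow> (nat \<Rightarrow>\<^sub>0 real) set"
  where "base_polytope \<B> = convex hull ((\<lambda>B. vec_on B (\<lambda>_. 1)) ` \<B>)"

definition schubert_expansion :: "nat \<Rightarrow> nat \<Rightarrow> nat set set \<Rightarrow> (nat set set \<Rightarrow> int) \<Rightarrow> bool"
  where "schubert_expansion r n \<M> a \<longleftrightarrow>
    (\<forall>x\<in>supported_on {1..n}.
      (indicator (base_polytope \<M>) x :: int) =
        (\<Sum>\<S>\<in>schubert_matroids r n. a \<S> * indicator (base_polytope \<S>) x))"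

text \<open>
  The integers \<open>a \<S>\<close> with \<open>\<S>\<close> in \<open>schubert_matroids r n\<close> are determined by \<open>\<M>\<close>. Hilbert choice is
  used rather than a definite description because \<open>a\<close> is unconstrained at other arguments; those
  values never enter below.
\<close>

definition schubert_coeff :: "nat \<Rightarrow> nat \<Rightarrow> nat set set \<Rightarrow> nat set set \<Rightarrow> int"
  where "schubert_coeff r n \<M> = (SOME a. schubert_expansion r n \<M> a)"

definition matroid_point :: "nat \<Rightarrow> nat \<Rightarrow> nat set set \<Rightarrow> (nat set set \<Rightarrow>\<^sub>0 real)"
  where "matroid_point r n \<M> =
    vec_on (schubert_matroids r n) (\<lambda>\<S>. of_int (schubert_coeff r n \<M> \<S>))"

definition polytope_of_matroids :: "nat \<Rightarrow> nat \<Rightarrow> (nat set set \<Rightarrow>\<^sub>0 real) set"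
  where "polytope_of_matroids r n = convex hull (matroid_point r n ` matroids r n)"

end

theory Submission
  imports Defs
begin

text \<open>
  Evaluating an expansion at a point \<open>x\<close> is a linear functional with integer coefficients. At a
  convex combination \<open>\<Sum>\<^sub>\<M> u\<^sub>\<M> p\<^sub>\<M>\<close> of matroid points it equals \<open>\<Sum>\<^sub>\<M> u\<^sub>\<M> 1\<^bsub>P(\<M>)\<^esub>(x)\<close>, which lies in
  \<open>[0, 1]\<close>; at an integer point it is therefore 0 or 1 for every \<open>x\<close>, which forces all matroids of
  positive weight to coincide. Hence the integer points are exactly the matroid points, and each of
  them is extreme.

  This rests on the existence of the expansion. For a chain \<open>C\<close> of subsets of the ground set, keeping
  only the rank inequalities \<open>x(F) \<le> rk(F)\<close> with \<open>F \<in> C\<close> describes the base polytope of a Schubert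
  matroid. For \<open>x\<close> in the hypersimplex let \<open>V\<close> be the family of all violated sets. Moebius inversion
  over chains yields integer coefficients for which the combination of the indicators of these
  polytopes has at \<open>x\<close> the value minus the reduced Euler characteristic of the order complex of
  \<open>V\<close>. This is 1 if \<open>V\<close> is empty, and otherwise 0 because supermodularity of \<open>x(F) - rk(F)\<close> makes
  \<open>V\<close> conically contractible.
\<close>

subsection \<open>Bases and rank\<close>

lemma matroid_finite: "matroid E \<B> \<Longrightarrow> finite \<B>"
  unfolding matroid_def by (meson PowI finite_Pow_iff finite_subset subsetI)

text \<open>Exchanging an element of \<open>B\<^sub>1 - B\<^sub>2\<close> for one of
  \<open>B\<^sub>2\<close> keeps the size and shrinks the difference. Used in both directions, this
  makes all bases equicardinal.\<close>

lemma matroid_card_le: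
  assumes M: "matroid E \<B>" and "B\<^sub>1 \<in> \<B>" "B\<^sub>2 \<in> \<B>"
  shows "card B\<^sub>1 \<le> card B\<^sub>2"
  using assms(2)
proof (induction "card (B\<^sub>1 - B\<^sub>2)" arbitrary: B\<^sub>1 rule: less_induct)
  case less
  have fin: "finite B\<^sub>1" "finite B\<^sub>2"
    using M less.prems assms(3) unfolding matroid_def by (meson finite_subset)+
  show ?case
  proof (cases "B\<^sub>1 \<subseteq> B\<^sub>2")
    case True
    then show ?thesis using fin by (simp add: card_mono)
  next
    case False
    then obtain x where x: "x \<in> B\<^sub>1 - B\<^sub>2" by blast
    then obtain y where y: "y \<in> B\<^sub>2 - B\<^sub>1" and B: "insert y (B\<^sub>1 - {x}) \<in> \<B>"
      using M less.prems assms(3) unfolding matroid_def by blast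
    have "insert y (B\<^sub>1 - {x}) - B\<^sub>2 = (B\<^sub>1 - B\<^sub>2) - {x}" using y by auto
    then have "card (insert y (B\<^sub>1 - {x}) - B\<^sub>2) < card (B\<^sub>1 - B\<^sub>2)"
      using x fin card_Diff1_less[of "B\<^sub>1 - B\<^sub>2" x] by auto
    then have "card (insert y (B\<^sub>1 - {x})) \<le> card B\<^sub>2" using less.hyps B by blast
    moreover have "card (insert y (B\<^sub>1 - {x})) = card B\<^sub>1"
      using x y fin card_Suc_Diff1[of B\<^sub>1 x] by auto
    ultimately show ?thesis by simp
  qed
qed

lemma mat_rank_ge: "matroid E \<B> \<Longrightarrow> B \<in> \<B> \<Longrightarrow> card (X \<inter> B) \<le> mat_rank \<B> X"
  unfolding mat_rank_def by (simp add: matroid_finite)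

lemma mat_rank_attained:
  assumes "matroid E \<B>"
  obtains B where "B \<in> \<B>" "card (X \<inter> B) = mat_rank \<B> X"
proof -
  have "mat_rank \<B> X \<in> (\<lambda>B. card (X \<inter> B)) ` \<B>"
    unfolding mat_rank_def
    by (rule Max_in) (use assms matroid_finite[OF assms] in \<open>auto simp: matroid_def\<close>)
  then show ?thesis using that by auto
qed

lemma mat_rank_mono:
  assumes "matroid E \<B>" "X \<subseteq> Y"
  shows "mat_rank \<B> X \<le> mat_rank \<B> Y"
proof -
  obtain B where B: "B \<in> \<B>" "card (X \<inter> B) = mat_rank \<B> X"
    using mat_rank_attained assms by metis
  have "finite B" using assms B unfolding matroid_def by (meson finite_subset)
  then have "card (X \<inter> B) \<le> card (Y \<inter> B)" using assms by (intro card_mono) auto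
  also have "\<dots> \<le> mat_rank \<B> Y" using mat_rank_ge assms B by blast
  finally show ?thesis using B by simp
qed

lemma matroid_card:
  assumes M: "matroid E \<B>" and B: "B \<in> \<B>"
  shows "card B = mat_rank \<B> E"
proof -
  obtain B' where B': "B' \<in> \<B>" "card (E \<inter> B') = mat_rank \<B> E"
    using mat_rank_attained M by metis
  moreover have "E \<inter> B' = B'" using M B'(1) unfolding matroid_def by blast
  ultimately show ?thesis
    using matroid_card_le[OF M] B by (metis order_antisym)
qed

text \<open>A base attaining the rank of \<open>S\<close> is moved towards one attaining the rank of
  \<open>T\<close> by exchanges that remove only elements outside \<open>T\<close>. Since
  \<open>S \<subseteq> T\<close>, such exchanges never lower the intersection with
  \<open>S\<close>.\<close>

lemma nested_rank_attained:
  assumes M: "matroid E \<B>" and ST: "S \<subseteq> T"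
  obtains B where "B \<in> \<B>" "card (S \<inter> B) = mat_rank \<B> S" "card (T \<inter> B) = mat_rank \<B> T"
proof -
  obtain B\<^sub>2 where B2: "B\<^sub>2 \<in> \<B>" "card (T \<inter> B\<^sub>2) = mat_rank \<B> T"
    using mat_rank_attained M by metis
  have "\<exists>B\<in>\<B>. card (S \<inter> B) = mat_rank \<B> S \<and> card (T \<inter> B) = mat_rank \<B> T"
    if "B\<^sub>1 \<in> \<B>" "card (S \<inter> B\<^sub>1) = mat_rank \<B> S" for B\<^sub>1
    using that
  proof (induction "card (B\<^sub>1 - B\<^sub>2)" arbitrary: B\<^sub>1 rule: less_induct)
    case less
    have fin: "finite B\<^sub>1" "finite B\<^sub>2"
      using M less.prems B2 unfolding matroid_def by (meson finite_subset)+
    show ?case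
    proof (cases "card (T \<inter> B\<^sub>1) = mat_rank \<B> T")
      case True
      then show ?thesis using less.prems by blast
    next
      case False
      \<comment> \<open>Bases have equal size, so the base with fewer elements in \<open>T\<close>
        has more outside \<open>T\<close>. This supplies an \<open>x\<close> to remove that lies
        neither in \<open>T\<close> nor in \<open>B\<^sub>2\<close>.\<close>
      then have "card (T \<inter> B\<^sub>1) < card (T \<inter> B\<^sub>2)"
        using mat_rank_ge[OF M] less.prems B2 by (metis le_neq_implies_less)
      moreover have "card B\<^sub>1 = card B\<^sub>2" using matroid_card M less.prems B2 by metis
      moreover have "card B\<^sub>1 = card (T \<inter> B\<^sub>1) + card (B\<^sub>1 - T)"
        "card B\<^sub>2 = card (T \<inter> B\<^sub>2) + card (B\<^sub>2 - T)"
        using fin by (metis Int_commute card_Int_Diff)+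
      ultimately have "\<not> card (B\<^sub>1 - T) \<le> card (B\<^sub>2 - T)" by simp
      then have "\<not> B\<^sub>1 - T \<subseteq> B\<^sub>2 - T" using fin by (meson card_mono finite_Diff)
      then obtain x where x: "x \<in> B\<^sub>1 - B\<^sub>2" "x \<notin> T" by blast
      then obtain y where y: "y \<in> B\<^sub>2 - B\<^sub>1" and B: "insert y (B\<^sub>1 - {x}) \<in> \<B>"
        using M less.prems B2 unfolding matroid_def by blast
      have "insert y (B\<^sub>1 - {x}) - B\<^sub>2 = (B\<^sub>1 - B\<^sub>2) - {x}" using y by auto
      then have "card (insert y (B\<^sub>1 - {x}) - B\<^sub>2) < card (B\<^sub>1 - B\<^sub>2)"
        using x fin card_Diff1_less[of "B\<^sub>1 - B\<^sub>2" x] by auto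
      moreover have "card (S \<inter> B\<^sub>1) \<le> card (S \<inter> insert y (B\<^sub>1 - {x}))"
        using x ST fin by (intro card_mono) auto
      then have "card (S \<inter> insert y (B\<^sub>1 - {x})) = mat_rank \<B> S"
        using less.prems mat_rank_ge[OF M B, of S] by simp
      ultimately show ?thesis using less.hyps B by blast
    qed
  qed
  then show ?thesis using mat_rank_attained[OF M] that by metis
qed

text \<open>One base attains the ranks of both \<open>X \<inter> Y\<close> and
  \<open>X \<union> Y\<close>. For it the claim is inclusion-exclusion, and its intersections with
  \<open>X\<close> and \<open>Y\<close> are bounded by their ranks.\<close>

lemma mat_rank_submodular:
  assumes M: "matroid E \<B>"
  shows "mat_rank \<B> (X \<union> Y) + mat_rank \<B> (X \<inter> Y) \<le> mat_rank \<B> X + mat_rank \<B> Y"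
proof -
  obtain B where B: "B \<in> \<B>" "card ((X \<inter> Y) \<inter> B) = mat_rank \<B> (X \<inter> Y)"
    "card ((X \<union> Y) \<inter> B) = mat_rank \<B> (X \<union> Y)"
    using nested_rank_attained[OF M, of "X \<inter> Y" "X \<union> Y"] by blast
  have "finite B" using M B unfolding matroid_def by (meson finite_subset)
  then have "card (X \<inter> B) + card (Y \<inter> B) = card ((X \<inter> B) \<union> (Y \<inter> B)) + card ((X \<inter> B) \<inter> (Y \<inter> B))"
    by (intro card_Un_Int) auto
  moreover have "(X \<inter> B) \<union> (Y \<inter> B) = (X \<union> Y) \<inter> B" "(X \<inter> B) \<inter> (Y \<inter> B) = (X \<inter> Y) \<inter> B" by auto
  ultimately show ?thesis
    using B mat_rank_ge[OF M B(1), of X] mat_rank_ge[OF M B(1), of Y] by simp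
qed

lemma sum_of_bool_card: "finite F \<Longrightarrow> sum (\<lambda>i. of_bool (i \<in> B) :: real) F = card (B \<inter> F)"
  by (simp add: of_bool_def sum.If_cases Int_commute)

subsection \<open>Ring families with a submodular bound\<close>

text \<open>Two instances occur: the power set of the ground set, which recovers a given matroid,
  and a chain with the ground set added, which gives Schubert matroids. In both, \<open>f\<close> is
  the rank function.\<close>

locale submodular_ring_family =
  fixes E :: "'a set" and \<F> :: "'a set set" and f :: "'a set \<Rightarrow> nat"
  assumes finite_ground: "finite E"
    and ground_mem: "E \<in> \<F>"
    and subset_ground: "F \<in> \<F> \<Longrightarrow> F \<subseteq> E"
    and Un_mem: "F \<in> \<F> \<Longrightarrow> G \<in> \<F> \<Longrightarrow> F \<union> G \<in> \<F>"
    and Int_mem: "F \<in> \<F> \<Longrightarrow> G \<in> \<F> \<Longrightarrow> F \<inter> G \<in> \<F>"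
    and submodular: "F \<in> \<F> \<Longrightarrow> G \<in> \<F> \<Longrightarrow> f (F \<union> G) + f (F \<inter> G) \<le> f F + f G"
begin

definition bases :: "'a set set"
  where "bases = {B. B \<subseteq> E \<and> card B = f E \<and> (\<forall>F\<in>\<F>. card (B \<inter> F) \<le> f F)}"

text \<open>The linear relaxation of \<open>bases\<close>. By \<open>hull_bases\<close> it is
  integral, hence the base polytope.\<close>

definition polytope :: "('a \<Rightarrow>\<^sub>0 real) set"
  where "polytope = {x \<in> supported_on E. (\<forall>i. 0 \<le> Poly_Mapping.lookup x i \<and> Poly_Mapping.lookup x i \<le> 1) \<and>
    sum (Poly_Mapping.lookup x) E = f E \<and> (\<forall>F\<in>\<F>. sum (Poly_Mapping.lookup x) F \<le> f F)}"

section \<open>Uncrossing of tight sets and the exchange axiom\<close>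

lemma finite_family: "finite \<F>"
  using finite_ground subset_ground by (meson PowI finite_Pow_iff finite_subset subsetI)

lemma finite_mem: "F \<in> \<F> \<Longrightarrow> finite F"
  using finite_ground subset_ground finite_subset by blast

text \<open>Uncrossing: the sum is modular and \<open>f\<close> is submodular, so two equalities
  leave no slack at the union or at the intersection.\<close>

lemma tight_Un_Int:
  fixes w :: "'a \<Rightarrow> real"
  assumes w: "\<And>F. F \<in> \<F> \<Longrightarrow> sum w F \<le> f F"
    and F: "F \<in> \<F>" "sum w F = f F" and G: "G \<in> \<F>" "sum w G = f G"
  shows "sum w (F \<union> G) = f (F \<union> G)" "sum w (F \<inter> G) = f (F \<inter> G)"
proof -
  have "sum w (F \<union> G) + sum w (F \<inter> G) = sum w F + sum w G"
    using F G finite_mem sum.union_inter by blast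
  moreover have "real (f (F \<union> G)) + real (f (F \<inter> G)) \<le> real (f F) + real (f G)"
    using submodular[OF F(1) G(1)] by linarith
  moreover have "sum w (F \<union> G) \<le> f (F \<union> G)" "sum w (F \<inter> G) \<le> f (F \<inter> G)"
    using w F G Un_mem Int_mem by blast+
  ultimately show "sum w (F \<union> G) = f (F \<union> G)" "sum w (F \<inter> G) = f (F \<inter> G)"
    using F G by linarith+
qed

lemma Union_tight:
  fixes w :: "'a \<Rightarrow> real"
  assumes w: "\<And>F. F \<in> \<F> \<Longrightarrow> sum w F \<le> f F"
    and "finite \<A>" "\<A> \<noteq> {}" "\<And>F. F \<in> \<A> \<Longrightarrow> F \<in> \<F> \<and> sum w F = f F"
  shows "\<Union>\<A> \<in> \<F> \<and> sum w (\<Union>\<A>) = f (\<Union>\<A>)"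
  using assms(2-)
proof (induction rule: finite_ne_induct)
  case (insert F \<A>)
  then have "F \<in> \<F>" "sum w F = f F" "\<Union>\<A> \<in> \<F>" "sum w (\<Union>\<A>) = f (\<Union>\<A>)" by auto
  then show ?case using tight_Un_Int(1)[OF w] Un_mem by auto
qed auto

lemma Inter_tight:
  fixes w :: "'a \<Rightarrow> real"
  assumes w: "\<And>F. F \<in> \<F> \<Longrightarrow> sum w F \<le> f F"
    and "finite \<A>" "\<A> \<noteq> {}" "\<And>F. F \<in> \<A> \<Longrightarrow> F \<in> \<F> \<and> sum w F = f F"
  shows "\<Inter>\<A> \<in> \<F> \<and> sum w (\<Inter>\<A>) = f (\<Inter>\<A>)"
  using assms(2-)
proof (induction rule: finite_ne_induct)
  case (insert F \<A>)
  then have "F \<in> \<F>" "sum w F = f F" "\<Inter>\<A> \<in> \<F>" "sum w (\<Inter>\<A>) = f (\<Inter>\<A>)" by auto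
  then show ?case using tight_Un_Int(2)[OF w] Int_mem by auto
qed auto

text \<open>The new element must avoid every set that is tight for \<open>B\<^sub>1\<close> and
  misses \<open>x\<close>. The union \<open>U\<close> of these sets is tight, so
  \<open>B\<^sub>1\<close> has at least as many elements in \<open>U\<close> as
  \<open>B\<^sub>2\<close>. If \<open>U\<close> contained \<open>B\<^sub>2 - B\<^sub>1\<close>, then
  outside \<open>U\<close> the base \<open>B\<^sub>2\<close> would be a proper subset of
  \<open>B\<^sub>1\<close>, contradicting equal size.\<close>

lemma bases_exchange:
  assumes B1: "B\<^sub>1 \<in> bases" and B2: "B\<^sub>2 \<in> bases" and x: "x \<in> B\<^sub>1 - B\<^sub>2"
  shows "\<exists>y\<in>B\<^sub>2 - B\<^sub>1. insert y (B\<^sub>1 - {x}) \<in> bases"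
proof -
  have fin: "finite B\<^sub>1" "finite B\<^sub>2"
    using B1 B2 finite_ground finite_subset unfolding bases_def by blast+
  have card_eq: "card B\<^sub>1 = card B\<^sub>2" using B1 B2 by (simp add: bases_def)
  define w where "w i = (of_bool (i \<in> B\<^sub>1) :: real)" for i
  have w_sum: "sum w F = card (B\<^sub>1 \<inter> F)" if "F \<in> \<F>" for F
    unfolding w_def using that finite_mem sum_of_bool_card by blast
  have w: "sum w F \<le> f F" if "F \<in> \<F>" for F
    using w_sum B1 that by (simp add: bases_def)
  define \<A> where "\<A> = {F \<in> \<F>. sum w F = f F \<and> x \<notin> F}"
  have "\<not> B\<^sub>2 - B\<^sub>1 \<subseteq> \<Union>\<A>"
  proof
    assume sub: "B\<^sub>2 - B\<^sub>1 \<subseteq> \<Union>\<A>"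
    show False
    proof (cases "\<A> = {}")
      case True
      then have "B\<^sub>2 \<subseteq> B\<^sub>1" using sub by auto
      then show False using card_eq fin x by (metis DiffE card_subset_eq)
    next
      case False
      define U where "U = \<Union>\<A>"
      have "finite \<A>" unfolding \<A>_def using finite_family by simp
      then have U: "U \<in> \<F>" "sum w U = f U"
        using Union_tight[OF w] False unfolding U_def \<A>_def by blast+
      have xU: "x \<notin> U" unfolding U_def \<A>_def by blast
      have "card (B\<^sub>2 \<inter> U) \<le> card (B\<^sub>1 \<inter> U)"
        using U w_sum[OF U(1)] B2 by (simp add: bases_def)
      moreover have "card (B\<^sub>2 \<inter> U) + card (B\<^sub>2 - U) = card B\<^sub>2" "card (B\<^sub>1 \<inter> U) + card (B\<^sub>1 - U) = card B\<^sub>1"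
        using fin card_Int_Diff by metis+
      ultimately have "card (B\<^sub>1 - U) \<le> card (B\<^sub>2 - U)" using card_eq by linarith
      moreover have "B\<^sub>2 - U \<subset> B\<^sub>1 - U" using sub x xU unfolding U_def by blast
      ultimately show False using fin by (meson finite_Diff leD psubset_card_mono)
    qed
  qed
  then obtain y where y: "y \<in> B\<^sub>2 - B\<^sub>1" "y \<notin> \<Union>\<A>" by blast
  have "card (insert y (B\<^sub>1 - {x}) \<inter> F) \<le> f F" if F: "F \<in> \<F>" for F
  proof -
    have F1: "card (B\<^sub>1 \<inter> F) \<le> f F" using B1 F by (simp add: bases_def)
    have step: "card (insert y (B\<^sub>1 - {x}) \<inter> F) \<le> Suc (card ((B\<^sub>1 - {x}) \<inter> F))"
      by (cases "y \<in> F") (use fin in \<open>auto simp: card_insert_if\<close>)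
    \<comment> \<open>The intersection with \<open>F\<close> grows only in the last case. There
      \<open>F\<close> contains \<open>y\<close> but not \<open>x\<close>, so by the choice of
      \<open>y\<close> it is not tight and has room for one more element.\<close>
    consider "y \<notin> F" | "y \<in> F" "x \<in> F" | "y \<in> F" "x \<notin> F" by blast
    then show ?thesis
    proof cases
      case 1
      then have "insert y (B\<^sub>1 - {x}) \<inter> F \<subseteq> B\<^sub>1 \<inter> F" by auto
      then show ?thesis using F1 fin by (meson card_mono finite_Int order_trans)
    next
      case 2
      then have "(B\<^sub>1 - {x}) \<inter> F = B\<^sub>1 \<inter> F - {x}" "x \<in> B\<^sub>1 \<inter> F" using x by auto
      then have "Suc (card ((B\<^sub>1 - {x}) \<inter> F)) = card (B\<^sub>1 \<inter> F)"
        using fin by (metis card_Suc_Diff1 finite_Int)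
      then show ?thesis using F1 step by simp
    next
      case 3
      then have "card (B\<^sub>1 \<inter> F) \<noteq> f F" using y F w_sum[OF F] unfolding \<A>_def by auto
      moreover have "(B\<^sub>1 - {x}) \<inter> F = B\<^sub>1 \<inter> F" using 3 by auto
      ultimately show ?thesis using F1 step by simp
    qed
  qed
  moreover have "card (insert y (B\<^sub>1 - {x})) = f E"
    using x y fin B1 card_Suc_Diff1[of B\<^sub>1 x] by (auto simp: bases_def)
  moreover have "insert y (B\<^sub>1 - {x}) \<subseteq> E" using y B1 B2 by (auto simp: bases_def)
  ultimately show ?thesis using y(1) unfolding bases_def by blast
qed

lemma matroid_bases: "bases \<noteq> {} \<Longrightarrow> matroid E bases"
  unfolding matroid_def using bases_exchange finite_ground by (auto simp: bases_def)

end

section \<open>Integrality of the polytope of a ring family\<close>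

lemma lookup_scaleR [simp]: "Poly_Mapping.lookup (c *\<^sub>R x) i = c *\<^sub>R Poly_Mapping.lookup x i"
proof -
  have "finite {i. c *\<^sub>R Poly_Mapping.lookup x i \<noteq> 0}"
    by (rule finite_subset[OF _ finite_lookup[of x]]) auto
  then show ?thesis by (simp add: scaleR_poly_mapping_def Abs_poly_mapping_inverse)
qed

lemma mem_supported_on: "x \<in> supported_on I \<longleftrightarrow> (\<forall>i. i \<notin> I \<longrightarrow> Poly_Mapping.lookup x i = 0)"
  by (auto simp: supported_on_def in_keys_iff)

context submodular_ring_family
begin

lemma convex_polytope: "convex polytope"
proof (rule convexI)
  fix x y :: "'a \<Rightarrow>\<^sub>0 real" and u v :: real
  assume x: "x \<in> polytope" and y: "y \<in> polytope" and uv: "0 \<le> u" "0 \<le> v" "u + v = 1"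
  have comb: "u * a + v * b \<le> c" if "a \<le> c" "b \<le> c" for a b c :: real
    using convex_bound_le[OF that uv] .
  have sums: "sum (Poly_Mapping.lookup (u *\<^sub>R x + v *\<^sub>R y)) F
      = u * sum (Poly_Mapping.lookup x) F + v * sum (Poly_Mapping.lookup y) F" for F
    by (simp add: lookup_add sum.distrib sum_distrib_left)
  show "u *\<^sub>R x + v *\<^sub>R y \<in> polytope"
    using x y uv unfolding polytope_def mem_supported_on mem_Collect_eq sums
    by (auto simp: lookup_add comb distrib_right[symmetric])
qed

lemma vec_on_bases_mem_polytope: "B \<in> bases \<Longrightarrow> vec_on B (\<lambda>_. 1) \<in> polytope"
proof -
  assume B: "B \<in> bases"
  then have fin: "finite B" and sub: "B \<subseteq> E"
    using finite_ground finite_subset unfolding bases_def by blast+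
  have l: "Poly_Mapping.lookup (vec_on B (\<lambda>_. 1)) = (\<lambda>i. of_bool (i \<in> B) :: real)"
    using fin by (auto simp: lookup_vec_on)
  have "sum (Poly_Mapping.lookup (vec_on B (\<lambda>_. 1))) F = card (B \<inter> F)" if "F \<in> \<F>" for F
    unfolding l using that finite_mem sum_of_bool_card by blast
  then show ?thesis
    using B sub ground_mem unfolding polytope_def mem_supported_on bases_def
    by (auto simp: l Int_absorb2)
qed

lemma mem_bases_if_vec_on_mem_polytope:
  assumes "finite B" "vec_on B (\<lambda>_. 1) \<in> polytope"
  shows "B \<in> bases"
proof -
  have l: "Poly_Mapping.lookup (vec_on B (\<lambda>_. 1)) = (\<lambda>i. of_bool (i \<in> B) :: real)"
    using assms(1) by (auto simp: lookup_vec_on)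
  have s: "sum (Poly_Mapping.lookup (vec_on B (\<lambda>_. 1))) F = card (B \<inter> F)" if "F \<in> \<F>" for F
    unfolding l using that finite_mem sum_of_bool_card by blast
  have "B \<subseteq> E"
    using assms(2) by (auto simp: polytope_def mem_supported_on l split: if_splits)
  then show ?thesis
    using assms(2) ground_mem unfolding polytope_def bases_def
    by (auto simp: s Int_absorb2)
qed

text \<open>Induction measure for integrality: it drops whenever a move inside the polytope makes a
  further constraint tight.\<close>

definition slack_count :: "('a \<Rightarrow> real) \<Rightarrow> nat"
  where "slack_count w = card {i\<in>E. w i \<noteq> 0 \<and> w i \<noteq> 1} + card {F\<in>\<F>. sum w F \<noteq> f F}"

text \<open>
  Moving along \<open>e\<^sub>i - e\<^sub>j\<close> until a new constraint becomes tight; a tight set that contains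
  both or neither of \<open>i\<close>, \<open>j\<close> stays tight.
\<close>

lemma shift_in_polytope:
  assumes x: "x \<in> polytope"
    and ij: "i \<in> E" "j \<in> E" "i \<noteq> j"
    and i: "Poly_Mapping.lookup x i < 1" "0 < Poly_Mapping.lookup x i"
    and j: "0 < Poly_Mapping.lookup x j" "Poly_Mapping.lookup x j < 1"
    and tight: "\<And>F. F \<in> \<F> \<Longrightarrow> sum (Poly_Mapping.lookup x) F = f F \<Longrightarrow> i \<in> F \<longleftrightarrow> j \<in> F"
  obtains \<epsilon> where "\<epsilon> > 0"
    "x + \<epsilon> *\<^sub>R (Poly_Mapping.single i 1 - Poly_Mapping.single j 1) \<in> polytope"
    "slack_count (Poly_Mapping.lookup (x + \<epsilon> *\<^sub>R (Poly_Mapping.single i 1 - Poly_Mapping.single j 1)))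
      < slack_count (Poly_Mapping.lookup x)"
proof -
  let ?w = "Poly_Mapping.lookup x"
  \<comment> \<open>The step lengths at which a constraint stops the move: coordinate
    \<open>i\<close> reaches 1, coordinate \<open>j\<close> reaches 0, or a member that gains
    weight, one with \<open>i\<close> but not \<open>j\<close>, is filled. The minimum is the
    longest admissible step.\<close>
  define S where "S = {1 - ?w i, ?w j} \<union> (\<lambda>F. f F - sum ?w F) ` {F\<in>\<F>. i \<in> F \<and> j \<notin> F}"
  define \<epsilon> where "\<epsilon> = Min S"
  have "finite S" "S \<noteq> {}" unfolding S_def using finite_family by auto
  then have \<epsilon>_in: "\<epsilon> \<in> S" and \<epsilon>_le: "\<And>s. s \<in> S \<Longrightarrow> \<epsilon> \<le> s" unfolding \<epsilon>_def by simp_all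
  have w_le: "sum ?w F \<le> f F" if "F \<in> \<F>" for F using x that by (simp add: polytope_def)
  have "s > 0" if "s \<in> S" for s
    using that i j w_le tight unfolding S_def by (fastforce simp: less_le)
  then have pos: "\<epsilon> > 0" using \<epsilon>_in by blast
  define y where "y = x + \<epsilon> *\<^sub>R (Poly_Mapping.single i 1 - Poly_Mapping.single j 1)"
  let ?v = "Poly_Mapping.lookup y"
  have v: "?v k = ?w k + \<epsilon> * (of_bool (k = i) - of_bool (k = j))" for k
    by (auto simp: y_def lookup_add lookup_minus lookup_single when_def)
  have v_sum: "sum ?v F = sum ?w F + \<epsilon> * (of_bool (i \<in> F) - of_bool (j \<in> F))" if "finite F" for F
    using that unfolding v
    by (simp add: sum.distrib sum_distrib_left[symmetric] sum_subtractf of_bool_def sum.delta)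
  have e1: "\<epsilon> \<le> 1 - ?w i" and e2: "\<epsilon> \<le> ?w j" using \<epsilon>_le unfolding S_def by auto
  have e3: "\<epsilon> \<le> f F - sum ?w F" if "F \<in> \<F>" "i \<in> F" "j \<notin> F" for F
    using \<epsilon>_le that unfolding S_def by blast
  have v_le: "sum ?v F \<le> f F" if F: "F \<in> \<F>" for F
    using w_le[OF F] e3[OF F] pos v_sum[OF finite_mem[OF F]] by (cases "i \<in> F"; cases "j \<in> F") auto
  have y: "y \<in> polytope"
  proof -
    have "0 \<le> ?v k \<and> ?v k \<le> 1" for k
      using x i j ij e1 e2 pos unfolding v polytope_def by (cases "k = i"; cases "k = j") auto
    moreover have "?v k = 0" if "k \<notin> E" for k
      using x ij that unfolding v polytope_def mem_supported_on by auto
    moreover have "sum ?v E = f E"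
      using x ij v_sum[OF finite_ground] unfolding polytope_def by simp
    ultimately show ?thesis unfolding polytope_def mem_supported_on using v_le by blast
  qed
  let ?A = "\<lambda>w. {i\<in>E. w i \<noteq> 0 \<and> w i \<noteq> (1::real)}"
  let ?B = "\<lambda>w::_ \<Rightarrow> real. {F\<in>\<F>. sum w F \<noteq> f F}"
  \<comment> \<open>Neither set counted by \<open>slack_count\<close> gains an element:
    \<open>i\<close> and \<open>j\<close> were fractional before the move, and tight sets keep their
    sum. The constraint attaining the minimum makes one of the two sets shrink.\<close>
  have A: "?A ?v \<subseteq> ?A ?w" using i j by (auto simp: v of_bool_def split: if_splits)
  have B: "?B ?v \<subseteq> ?B ?w"
    using tight v_sum finite_mem by auto
  have fin: "finite (?A w)" "finite (?B w)" for w using finite_ground finite_family by auto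
  consider "\<epsilon> = 1 - ?w i" | "\<epsilon> = ?w j" | F where "F \<in> \<F>" "i \<in> F" "j \<notin> F" "\<epsilon> = f F - sum ?w F"
    using \<epsilon>_in unfolding S_def by blast
  then have "?A ?v \<subset> ?A ?w \<or> ?B ?v \<subset> ?B ?w"
  proof cases
    case 1
    then have "i \<notin> ?A ?v" "i \<in> ?A ?w" using ij i by (auto simp: v)
    then show ?thesis using A by blast
  next
    case 2
    then have "j \<notin> ?A ?v" "j \<in> ?A ?w" using ij j by (auto simp: v)
    then show ?thesis using A by blast
  next
    case 3
    then have "F \<notin> ?B ?v" "F \<in> ?B ?w" using pos v_sum[OF finite_mem] by auto
    then show ?thesis using B by blast
  qed
  then have "slack_count ?v < slack_count ?w"
    unfolding slack_count_def
    using card_mono[OF fin(1) A] card_mono[OF fin(2) B]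
      psubset_card_mono[OF fin(1), of "?A ?v" ?w] psubset_card_mono[OF fin(2), of "?B ?v" ?w]
    by linarith
  then show ?thesis using that pos y unfolding y_def by blast
qed

text \<open>Let \<open>D i\<close> be the least tight member containing \<open>i\<close>, and take a
  fractional \<open>i\<close> with \<open>D i\<close> of minimal size. The sum over
  \<open>D i\<close> is an integer, so \<open>D i\<close> holds a second fractional index
  \<open>j\<close>. Then \<open>D j \<subseteq> D i\<close>, and minimality gives equality, so the
  same tight members contain \<open>i\<close> and \<open>j\<close>.\<close>

lemma obtain_unseparated_pair:
  assumes x: "x \<in> polytope" and k: "Poly_Mapping.lookup x k \<noteq> 0" "Poly_Mapping.lookup x k \<noteq> 1"
  obtains i j where "i \<in> E" "j \<in> E" "i \<noteq> j"
    "Poly_Mapping.lookup x i \<noteq> 0" "Poly_Mapping.lookup x i \<noteq> 1"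
    "Poly_Mapping.lookup x j \<noteq> 0" "Poly_Mapping.lookup x j \<noteq> 1"
    "\<And>F. F \<in> \<F> \<Longrightarrow> sum (Poly_Mapping.lookup x) F = f F \<Longrightarrow> i \<in> F \<longleftrightarrow> j \<in> F"
proof -
  let ?w = "Poly_Mapping.lookup x"
  define T where "T i = {F\<in>\<F>. sum ?w F = f F \<and> i \<in> F}" for i
  define D where "D i = \<Inter>(T i)" for i
  define Fr where "Fr = {i\<in>E. ?w i \<noteq> 0 \<and> ?w i \<noteq> 1}"
  have w: "sum ?w F \<le> f F" if "F \<in> \<F>" for F using x that by (simp add: polytope_def)
  have E_T: "E \<in> T i" if "i \<in> E" for i
    using x ground_mem that unfolding T_def polytope_def by auto
  have D: "D i \<in> \<F> \<and> sum ?w (D i) = f (D i)" if "i \<in> E" for i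
    unfolding D_def
    by (rule Inter_tight[OF w]) (use E_T that finite_family in \<open>auto simp: T_def\<close>)
  have D_self: "i \<in> D i" for i unfolding D_def T_def by blast
  have "k \<in> Fr" using k x unfolding Fr_def polytope_def mem_supported_on by auto
  then obtain i where i: "i \<in> Fr" and min: "\<And>j. j \<in> Fr \<Longrightarrow> card (D i) \<le> card (D j)"
    using arg_min_nat_lemma[of "\<lambda>i. i \<in> Fr" k "\<lambda>i. card (D i)"] by blast
  have iE: "i \<in> E" using i Fr_def by blast
  have "\<exists>j\<in>D i. j \<noteq> i \<and> j \<in> Fr"
  proof (rule ccontr)
    assume "\<not> ?thesis"
    then have int: "?w j \<in> \<int>" if "j \<in> D i - {i}" for j
      using that D iE subset_ground unfolding Fr_def by fastforce
    have "sum ?w (D i) = ?w i + sum ?w (D i - {i})"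
      using D D_self finite_mem iE by (meson sum.remove)
    moreover have "sum ?w (D i - {i}) \<in> \<int>" using int by (rule Ints_sum)
    moreover have "sum ?w (D i) \<in> \<int>" using D iE by simp
    ultimately have "?w i \<in> \<int>" by (metis Ints_diff add_diff_cancel_right')
    moreover have "0 < ?w i" "?w i < 1" using x i unfolding Fr_def polytope_def by (auto simp: less_le)
    ultimately show False by (auto elim!: Ints_cases)
  qed
  then obtain j where j: "j \<in> D i" "j \<noteq> i" "j \<in> Fr" by blast
  have jE: "j \<in> E" using j Fr_def by blast
  have "D i \<in> T j" using D iE j unfolding T_def by blast
  then have "D j \<subseteq> D i" unfolding D_def[of j] by blast
  then have "D j = D i"
    using min[OF j(3)] D[OF iE] finite_mem by (meson card_seteq)
  then have "i \<in> F \<longleftrightarrow> j \<in> F" if "F \<in> \<F>" "sum ?w F = f F" for F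
    using that D_self j(1) unfolding D_def T_def by blast
  then show ?thesis using that[of i j] iE jE i j unfolding Fr_def by blast
qed

text \<open>A 0/1 point is the indicator vector of a base. Any other point lies strictly between two
  points of smaller \<open>slack_count\<close>, found by moving in opposite directions along the
  difference of two unit vectors.\<close>

lemma polytope_subset_hull: "x \<in> polytope \<Longrightarrow> x \<in> convex hull ((\<lambda>B. vec_on B (\<lambda>_. 1)) ` bases)"
proof (induction "slack_count (Poly_Mapping.lookup x)" arbitrary: x rule: less_induct)
  case less
  let ?w = "Poly_Mapping.lookup x"
  let ?H = "convex hull ((\<lambda>B. vec_on B (\<lambda>_. 1)) ` bases)"
  have w01: "0 \<le> ?w i \<and> ?w i \<le> 1" for i using less.prems by (simp add: polytope_def)
  show ?case
  proof (cases "\<exists>k. ?w k \<noteq> 0 \<and> ?w k \<noteq> 1")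
    case False
    define B where "B = {i. ?w i = 1}"
    have "B \<subseteq> E" using less.prems unfolding B_def polytope_def mem_supported_on by force
    then have fin: "finite B" using finite_ground finite_subset by blast
    have "x = vec_on B (\<lambda>_. 1)"
      by (rule poly_mapping_eqI) (use False fin in \<open>auto simp: lookup_vec_on B_def\<close>)
    then show ?thesis
      using mem_bases_if_vec_on_mem_polytope[OF fin] less.prems by (simp add: hull_inc)
  next
    case True
    then obtain i j where ij: "i \<in> E" "j \<in> E" "i \<noteq> j" "?w i \<noteq> 0" "?w i \<noteq> 1" "?w j \<noteq> 0" "?w j \<noteq> 1"
      and tight: "\<And>F. F \<in> \<F> \<Longrightarrow> sum ?w F = f F \<Longrightarrow> i \<in> F \<longleftrightarrow> j \<in> F"
      using obtain_unseparated_pair[OF less.prems] by metis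
    have frac: "0 < ?w i" "?w i < 1" "0 < ?w j" "?w j < 1" using ij w01 by (auto simp: less_le)
    let ?d = "Poly_Mapping.single i 1 - Poly_Mapping.single j (1::real)"
    obtain \<epsilon> where \<epsilon>: "\<epsilon> > 0" "x + \<epsilon> *\<^sub>R ?d \<in> ?H"
      using shift_in_polytope[OF less.prems, of i j] ij frac tight less.hyps by metis
    obtain \<delta> where \<delta>: "\<delta> > 0" "x + \<delta> *\<^sub>R (- ?d) \<in> ?H"
      using shift_in_polytope[OF less.prems, of j i] ij frac tight less.hyps by (metis minus_diff_eq)
    \<comment> \<open>The weights are inversely proportional to the step lengths, so the
      displacements cancel.\<close>
    have "(\<delta> / (\<epsilon> + \<delta>)) *\<^sub>R (x + \<epsilon> *\<^sub>R ?d) + (\<epsilon> / (\<epsilon> + \<delta>)) *\<^sub>R (x + \<delta> *\<^sub>R (- ?d)) \<in> ?H"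
      using convexD[OF convex_convex_hull \<epsilon>(2) \<delta>(2)] \<epsilon>(1) \<delta>(1)
      by (simp add: add_divide_distrib[symmetric] add.commute)
    also have "(\<delta> / (\<epsilon> + \<delta>)) *\<^sub>R (x + \<epsilon> *\<^sub>R ?d) + (\<epsilon> / (\<epsilon> + \<delta>)) *\<^sub>R (x + \<delta> *\<^sub>R (- ?d))
      = (\<delta> / (\<epsilon> + \<delta>) + \<epsilon> / (\<epsilon> + \<delta>)) *\<^sub>R x"
      by (simp add: algebra_simps)
    also have "\<delta> / (\<epsilon> + \<delta>) + \<epsilon> / (\<epsilon> + \<delta>) = 1"
      using \<epsilon>(1) \<delta>(1) by (simp add: add_divide_distrib[symmetric] add.commute)
    finally show ?thesis by simp
  qed
qed

lemma hull_bases: "convex hull ((\<lambda>B. vec_on B (\<lambda>_. 1)) ` bases) = polytope"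
  using polytope_subset_hull vec_on_bases_mem_polytope
  by (intro equalityI hull_minimal convex_polytope subsetI) auto

end

subsection \<open>Cyclic flats\<close>

context submodular_ring_family
begin

lemma bases_subset: "B \<in> bases \<Longrightarrow> B \<subseteq> E"
  by (simp add: bases_def)

text \<open>The rank bounds thus characterise independence. A smaller \<open>X\<close> is enlarged
  by an element of \<open>B\<close> outside the union \<open>U\<close> of its tight sets. One
  exists: \<open>X\<close> has at least as many elements in \<open>U\<close> as \<open>B\<close>, so
  \<open>B\<close>, being larger, has more outside \<open>U\<close> than \<open>X\<close>.\<close>

lemma bounded_extends_to_base:
  assumes B: "B \<in> bases" and X: "X \<subseteq> E" "\<And>F. F \<in> \<F> \<Longrightarrow> card (X \<inter> F) \<le> f F"
  shows "\<exists>B'\<in>bases. X \<subseteq> B'"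
  using X
proof (induction "f E - card X" arbitrary: X rule: less_induct)
  case less
  have fin: "finite X" "finite B"
    using less.prems(1) B bases_subset finite_ground finite_subset by blast+
  have "X \<inter> E = X" using less.prems(1) by blast
  then have X_le: "card X \<le> f E" using less.prems(2)[OF ground_mem] by simp
  show ?case
  proof (cases "card X = f E")
    case True
    then show ?thesis using less.prems unfolding bases_def by blast
  next
    case False
    then have lt: "card X < card B" using X_le B by (simp add: bases_def)
    define w where "w i = (of_bool (i \<in> X) :: real)" for i
    have w_sum: "sum w F = card (X \<inter> F)" if "F \<in> \<F>" for F
      unfolding w_def using that finite_mem sum_of_bool_card by blast
    have w: "sum w F \<le> f F" if "F \<in> \<F>" for F
      using w_sum[OF that] less.prems(2)[OF that] by simp
    define \<A> where "\<A> = {F \<in> \<F>. sum w F = f F}"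
    have "finite \<A>" unfolding \<A>_def using finite_family by simp
    have "\<not> B - X \<subseteq> \<Union>\<A>"
    proof
      assume sub: "B - X \<subseteq> \<Union>\<A>"
      show False
      proof (cases "\<A> = {}")
        case True
        then have "B \<subseteq> X" using sub by auto
        then show False using lt fin by (simp add: card_mono leD)
      next
        case False
        define U where "U = \<Union>\<A>"
        have U: "U \<in> \<F>" "sum w U = f U"
          using Union_tight[OF w \<open>finite \<A>\<close>] False unfolding U_def \<A>_def by blast+
        have "card (B \<inter> U) \<le> card (X \<inter> U)"
          using U w_sum[OF U(1)] B by (simp add: bases_def)
        moreover have "card (B \<inter> U) + card (B - U) = card B" "card (X \<inter> U) + card (X - U) = card X"
          using fin card_Int_Diff by metis+
        ultimately have "card (X - U) < card (B - U)" using lt by linarith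
        moreover have "B - U \<subseteq> X - U" using sub unfolding U_def by blast
        then have "card (B - U) \<le> card (X - U)" using fin by (simp add: card_mono)
        ultimately show False by simp
      qed
    qed
    then obtain y where y: "y \<in> B - X" "y \<notin> \<Union>\<A>" by blast
    have "card (insert y X \<inter> F) \<le> f F" if F: "F \<in> \<F>" for F
    proof (cases "y \<in> F")
      case True
      then have "card (X \<inter> F) \<noteq> f F" using y F w_sum[OF F] unfolding \<A>_def by auto
      then show ?thesis using less.prems(2)[OF F] True fin y by (simp add: card_insert_if)
    qed (use less.prems(2)[OF F] in simp)
    moreover have "insert y X \<subseteq> E" using y B less.prems(1) bases_subset by blast
    moreover have "card (insert y X) = Suc (card X)" using y fin by simp
    then have "f E - card (insert y X) < f E - card X" using lt B by (simp add: bases_def)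
    ultimately obtain B' where "B' \<in> bases" "insert y X \<subseteq> B'" using less.hyps by blast
    then show ?thesis by blast
  qed
qed

text \<open>Dependence of \<open>K\<close> means that it breaks the bound of some member
  \<open>F\<close>. Every proper subset of \<open>K\<close> obeys that bound, so
  \<open>K \<subseteq> F\<close>. Deleting one element of \<open>K\<close> leaves an independent set
  of size at least \<open>f F\<close>, so \<open>K\<close> spans \<open>F\<close>.\<close>

lemma circuit_member:
  assumes B: "B \<in> bases" and K: "mat_circuit E bases K"
  obtains F where "F \<in> \<F>" "K \<subseteq> F" "mat_rank bases F \<le> mat_rank bases K"
proof -
  have M: "matroid E bases" using matroid_bases B by blast
  have KE: "K \<subseteq> E" and dep: "\<not> mat_indep bases K"
    and ind: "\<And>X. X \<subset> K \<Longrightarrow> mat_indep bases X"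
    using K unfolding mat_circuit_def by blast+
  have fin: "finite K" using KE finite_ground finite_subset by blast
  obtain F where F: "F \<in> \<F>" "f F < card (K \<inter> F)"
    using dep bounded_extends_to_base[OF B KE] unfolding mat_indep_def by (meson not_le)
  have "K \<subseteq> F"
  proof (rule ccontr)
    assume "\<not> K \<subseteq> F"
    then obtain B' where B': "B' \<in> bases" "K \<inter> F \<subseteq> B'"
      using ind[of "K \<inter> F"] unfolding mat_indep_def by blast
    have "finite (B' \<inter> F)" using F finite_mem by blast
    then have "card (K \<inter> F) \<le> card (B' \<inter> F)" using B' by (intro card_mono) auto
    then show False using B' F unfolding bases_def by fastforce
  qed
  have "K \<inter> F \<noteq> {}" using F(2) by force
  then obtain z where z: "z \<in> K" by blast
  then obtain B' where B': "B' \<in> bases" "K - {z} \<subseteq> B'"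
    using ind[of "K - {z}"] unfolding mat_indep_def by blast
  have "f F < card K" using F(2) \<open>K \<subseteq> F\<close> by (simp add: Int_absorb2)
  then have "f F \<le> card (K - {z})" using z fin card_Suc_Diff1[of K z] by simp
  also have "\<dots> \<le> card (K \<inter> B')" using B' fin by (intro card_mono) auto
  also have "\<dots> \<le> mat_rank bases K" using mat_rank_ge[OF M B'(1)] .
  finally have "f F \<le> mat_rank bases K" .
  moreover have "mat_rank bases F \<le> f F"
  proof -
    obtain B'' where "B'' \<in> bases" "card (F \<inter> B'') = mat_rank bases F"
      using mat_rank_attained[OF M] by metis
    then show ?thesis using F(1) unfolding bases_def by (metis (no_types, lifting) Int_commute mem_Collect_eq)
  qed
  ultimately show ?thesis using that F(1) \<open>K \<subseteq> F\<close> by simp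
qed

text \<open>As \<open>K\<close> spans \<open>F\<close>, adding an element of \<open>F\<close> to
  \<open>K\<close> does not raise the rank. By submodularity adding it to \<open>G\<close> does not
  either, so the flat \<open>G\<close> already contains it.\<close>

lemma flat_contains_member:
  assumes M: "matroid E bases" and G: "mat_flat E bases G" and K: "K \<subseteq> G" "K \<subseteq> F"
    and F: "F \<in> \<F>" "mat_rank bases F \<le> mat_rank bases K"
  shows "F \<subseteq> G"
proof (rule ccontr)
  assume "\<not> F \<subseteq> G"
  then obtain e where e: "e \<in> F" "e \<notin> G" by blast
  then have "e \<in> E - G" using subset_ground F by blast
  then have "mat_rank bases G < mat_rank bases (insert e G)"
    using G unfolding mat_flat_def by blast
  moreover have "mat_rank bases (G \<union> insert e K) + mat_rank bases (G \<inter> insert e K)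
    \<le> mat_rank bases G + mat_rank bases (insert e K)"
    using mat_rank_submodular[OF M] .
  moreover have "G \<union> insert e K = insert e G" "G \<inter> insert e K = K" using K e by auto
  moreover have "mat_rank bases (insert e K) \<le> mat_rank bases F"
    using mat_rank_mono[OF M] K e by simp
  ultimately show False using F by simp
qed

text \<open>Each circuit in \<open>G\<close> spans a member of the family that contains it, and
  flatness forces that member into \<open>G\<close>.\<close>

lemma cyclic_flat_eq_Union:
  assumes B: "B \<in> bases" and G: "G \<in> cyclic_flats E bases"
  shows "G = \<Union>{F\<in>\<F>. F \<subseteq> G}"
proof
  obtain \<K> where \<K>: "\<And>K. K \<in> \<K> \<Longrightarrow> mat_circuit E bases K" "G = \<Union>\<K>"
    using G unfolding cyclic_flats_def mat_cyclic_def by blast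
  have flat: "mat_flat E bases G" using G unfolding cyclic_flats_def by blast
  have M: "matroid E bases" using matroid_bases B by blast
  show "G \<subseteq> \<Union>{F\<in>\<F>. F \<subseteq> G}"
  proof
    fix g assume "g \<in> G"
    then obtain K where K: "K \<in> \<K>" "g \<in> K" using \<K> by blast
    obtain F where F: "F \<in> \<F>" "K \<subseteq> F" "mat_rank bases F \<le> mat_rank bases K"
      using circuit_member[OF B \<K>(1)[OF K(1)]] by blast
    have "F \<subseteq> G" using flat_contains_member[OF M flat _ F(2,1,3)] K \<K>(2) by blast
    then show "g \<in> \<Union>{F\<in>\<F>. F \<subseteq> G}" using F K by blast
  qed
qed blast

text \<open>Cyclic flats are unions of members of the chain. A member \<open>F\<close> inside
  \<open>G\<close> but not inside \<open>H\<close> contains every member inside \<open>H\<close>,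
  whence \<open>H \<subseteq> F \<subseteq> G\<close>.\<close>

lemma chain_cyclic_flats:
  assumes chain: "chain\<^sub>\<subseteq> \<F>" and B: "B \<in> bases"
  shows "chain\<^sub>\<subseteq> (cyclic_flats E bases)"
  unfolding chain_subset_def
proof (intro ballI)
  fix G H assume G: "G \<in> cyclic_flats E bases" and H: "H \<in> cyclic_flats E bases"
  have "H \<subseteq> G" if "\<not> G \<subseteq> H"
  proof -
    have "\<exists>F\<in>\<F>. F \<subseteq> G \<and> \<not> F \<subseteq> H"
      using that cyclic_flat_eq_Union[OF B G] by blast
    then obtain F where F: "F \<in> \<F>" "F \<subseteq> G" "\<not> F \<subseteq> H" by blast
    have "F' \<subseteq> F" if "F' \<in> \<F>" "F' \<subseteq> H" for F'
      using chain F that unfolding chain_subset_def by (meson order_trans)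
    then have "\<Union>{F\<in>\<F>. F \<subseteq> H} \<subseteq> F" by blast
    then show ?thesis using F cyclic_flat_eq_Union[OF B H] by simp
  qed
  then show "G \<subseteq> H \<or> H \<subseteq> G" by blast
qed

end

subsection \<open>Alternating sums over chains of sets\<close>

definition set_chains :: "'a set set \<Rightarrow> 'a set set set"
  where "set_chains \<V> = {D. D \<subseteq> \<V> \<and> chain\<^sub>\<subseteq> D}"

text \<open>The empty chain counts with sign +1, so this is minus the reduced Euler characteristic
  of the order complex.\<close>

definition chain_sum :: "'a set set \<Rightarrow> int"
  where "chain_sum \<V> = (\<Sum>D\<in>set_chains \<V>. (-1) ^ card D)"

lemma finite_set_chains: "finite \<V> \<Longrightarrow> finite (set_chains \<V>)"
  unfolding set_chains_def by (rule finite_subset[of _ "Pow \<V>"]) auto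

lemma set_chains_subset: "D \<in> set_chains \<V> \<Longrightarrow> C \<subseteq> D \<Longrightarrow> C \<in> set_chains \<V>"
  unfolding set_chains_def chain_subset_def mem_Collect_eq by (meson order_trans subsetD)

lemma chain_sum_empty [simp]: "chain_sum {} = 1"
proof -
  have "set_chains ({} :: 'a set set) = {{}}" by (auto simp: set_chains_def chain_subset_def)
  then show ?thesis by (simp add: chain_sum_def)
qed

text \<open>Deletion and link: chains through \<open>G\<close> correspond to chains of sets
  comparable with \<open>G\<close>, with the opposite sign.\<close>

lemma chain_sum_remove:
  assumes fin: "finite \<V>" and G: "G \<in> \<V>"
  shows "chain_sum \<V> = chain_sum (\<V> - {G}) - chain_sum {H \<in> \<V> - {G}. H \<subseteq> G \<or> G \<subseteq> H}"
proof -
  let ?L = "{H \<in> \<V> - {G}. H \<subseteq> G \<or> G \<subseteq> H}"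
  have finL: "finite ?L" using fin by simp
  have "set_chains \<V> \<subseteq> set_chains (\<V> - {G}) \<union> insert G ` set_chains ?L"
  proof
    fix D assume D: "D \<in> set_chains \<V>"
    show "D \<in> set_chains (\<V> - {G}) \<union> insert G ` set_chains ?L"
    proof (cases "G \<in> D")
      case True
      then have "D = insert G (D - {G})" by blast
      moreover have "D - {G} \<in> set_chains ?L"
        using D True unfolding set_chains_def chain_subset_def by blast
      ultimately show ?thesis by blast
    next
      case False
      then show ?thesis using D unfolding set_chains_def by blast
    qed
  qed
  moreover have "set_chains (\<V> - {G}) \<union> insert G ` set_chains ?L \<subseteq> set_chains \<V>"
    using G unfolding set_chains_def chain_subset_def by blast
  ultimately have eq: "set_chains \<V> = set_chains (\<V> - {G}) \<union> insert G ` set_chains ?L" by blast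
  have notin: "G \<notin> D" if "D \<in> set_chains ?L" for D using that unfolding set_chains_def by blast
  have inj: "inj_on (insert G) (set_chains ?L)"
    using notin by (intro inj_onI) (metis insert_ident)
  have "(\<Sum>D\<in>insert G ` set_chains ?L. (-1) ^ card D) = (\<Sum>D\<in>set_chains ?L. (-1 :: int) ^ card (insert G D))"
    by (simp only: sum.reindex[OF inj] o_def)
  also have "\<dots> = (\<Sum>D\<in>set_chains ?L. - ((-1) ^ card D))"
  proof (rule sum.cong)
    fix D assume D: "D \<in> set_chains ?L"
    then have "finite D" using finL finite_subset unfolding set_chains_def by blast
    then show "(-1 :: int) ^ card (insert G D) = - ((-1) ^ card D)" using notin[OF D] by simp
  qed simp
  also have "\<dots> = - chain_sum ?L" by (simp add: chain_sum_def sum_negf)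
  finally have ins: "(\<Sum>D\<in>insert G ` set_chains ?L. (-1) ^ card D) = - chain_sum ?L" .
  have "set_chains (\<V> - {G}) \<inter> insert G ` set_chains ?L = {}"
    unfolding set_chains_def by blast
  then have "chain_sum \<V> = chain_sum (\<V> - {G}) + (\<Sum>D\<in>insert G ` set_chains ?L. (-1) ^ card D)"
    unfolding chain_sum_def eq
    by (intro sum.union_disjoint finite_imageI finite_set_chains finL finite_Diff fin)
  then show ?thesis using ins by simp
qed

text \<open>
  Such a family is conically contractible, through \<open>G \<supseteq> G \<inter> m \<subseteq> m\<close>, so its order complex has
  vanishing reduced Euler characteristic.
\<close>

lemma chain_sum_conical:
  assumes "finite \<V>" "m \<in> \<V>" "\<And>G. G \<in> \<V> \<Longrightarrow> G \<inter> m \<in> \<V>"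
  shows "chain_sum \<V> = 0"
  using assms
proof (induction "card \<V>" arbitrary: \<V> m rule: less_induct)
  case less
  show ?case
  proof (cases "\<forall>G\<in>\<V>. G \<subseteq> m")
    case True
    \<comment> \<open>All sets are comparable with \<open>m\<close>, so its deletion and its link
      coincide and the two terms cancel.\<close>
    then have "{H \<in> \<V> - {m}. H \<subseteq> m \<or> m \<subseteq> H} = \<V> - {m}" by blast
    then show ?thesis using chain_sum_remove[OF less.prems(1,2)] by simp
  next
    case False
    then obtain G where G: "G \<in> \<V>" "\<not> G \<subseteq> m" by blast
    let ?L = "{H \<in> \<V> - {G}. H \<subseteq> G \<or> G \<subseteq> H}"
    have lt: "card (\<V> - {G}) < card \<V>" using less.prems(1) G by (simp add: card_Diff1_less del: card_Diff_insert card_Diff_singleton)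
    have "card ?L \<le> card (\<V> - {G})" using less.prems(1) by (intro card_mono) auto
    with lt have ltL: "card ?L < card \<V>" by simp
    \<comment> \<open>The link of \<open>G\<close> is conical with apex \<open>G \<inter> m\<close>,
      which differs from \<open>G\<close> as \<open>G\<close> is not inside \<open>m\<close>.
      Intersecting \<open>H\<close> with the apex gives \<open>H \<inter> m\<close> if
      \<open>H\<close> lies below \<open>G\<close>, and the apex itself if \<open>H\<close> lies
      above \<open>G\<close>.\<close>
    have apex: "G \<inter> m \<in> ?L" using less.prems(3)[OF G(1)] G(2) by blast
    have "H \<inter> (G \<inter> m) \<in> ?L" if H: "H \<in> ?L" for H
    proof -
      have "H \<inter> (G \<inter> m) = H \<inter> m \<or> H \<inter> (G \<inter> m) = G \<inter> m" using H by blast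
      then have "H \<inter> (G \<inter> m) \<in> \<V>" using less.prems(3) H G by fastforce
      then show ?thesis using G(2) by blast
    qed
    then have "chain_sum ?L = 0"
      using less.hyps[OF ltL _ apex] less.prems(1) finite_subset[of ?L \<V>] by blast
    \<comment> \<open>Deleting \<open>G\<close> keeps the apex \<open>m\<close>: no intersection
      with \<open>m\<close> equals \<open>G\<close>.\<close>
    moreover have "chain_sum (\<V> - {G}) = 0"
      using less.hyps[OF lt, of m] less.prems G by auto
    ultimately show ?thesis using chain_sum_remove[OF less.prems(1) G(1)] by simp
  qed
qed

section \<open>Moebius inversion over chains\<close>

lemma sum_Pow_alternating:
  assumes "finite A"
  shows "(\<Sum>X\<in>Pow A. (-1 :: int) ^ card X) = of_bool (A = {})"
proof -
  have "(\<Sum>X\<in>Pow A. (-1 :: int) ^ card X) = (\<Prod>x\<in>A. 1 - 1)"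
    using prod_diff_conv_sum[OF assms, of "\<lambda>_. 1 :: int" "\<lambda>_. 1"] by simp
  then show ?thesis using assms by (auto simp: prod_zero)
qed

text \<open>Obtained by writing the condition \<open>D \<subseteq> \<V>\<close> in
  \<open>chain_sum\<close> as an alternating sum over the subsets \<open>C\<close> of
  \<open>D\<close> disjoint from \<open>\<V>\<close>, and collecting terms by \<open>C\<close>. The
  resulting coefficients do not depend on \<open>\<V>\<close>.\<close>

definition chain_coeff :: "'a set set \<Rightarrow> 'a set set \<Rightarrow> int"
  where "chain_coeff \<L> C = (\<Sum>D\<in>{D\<in>set_chains \<L>. C \<subseteq> D}. (-1) ^ card D * (-1) ^ card C)"

lemma sum_chain_coeff:
  assumes fin: "finite \<L>" and V: "\<V> \<subseteq> \<L>"
  shows "(\<Sum>C\<in>set_chains \<L>. chain_coeff \<L> C * of_bool (C \<inter> \<V> = {})) = chain_sum \<V>"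
proof -
  have fin': "finite (set_chains \<L>)" using finite_set_chains fin by blast
  have "(\<Sum>C\<in>set_chains \<L>. chain_coeff \<L> C * of_bool (C \<inter> \<V> = {}))
    = (\<Sum>C\<in>set_chains \<L>. \<Sum>D\<in>set_chains \<L>.
        if C \<subseteq> D then (-1) ^ card D * ((-1) ^ card C * of_bool (C \<inter> \<V> = {})) else 0)"
    unfolding chain_coeff_def sum.inter_filter[OF fin'] sum_distrib_right
    by (intro sum.cong refl) simp
  also have "\<dots> = (\<Sum>D\<in>set_chains \<L>. \<Sum>C\<in>set_chains \<L>.
        if C \<subseteq> D then (-1) ^ card D * ((-1) ^ card C * of_bool (C \<inter> \<V> = {})) else 0)"
    by (rule sum.swap)
  also have "\<dots> = (\<Sum>D\<in>set_chains \<L>. if D \<subseteq> \<V> then (-1) ^ card D else 0)"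
  proof (rule sum.cong)
    fix D assume D: "D \<in> set_chains \<L>"
    then have finD: "finite D" using fin finite_subset unfolding set_chains_def by blast
    \<comment> \<open>For fixed \<open>D\<close> the contributing \<open>C\<close> are the subsets
      of \<open>D - \<V>\<close>, all of them chains. Their alternating sum vanishes unless
      \<open>D \<subseteq> \<V>\<close>.\<close>
    have "(\<Sum>C\<in>set_chains \<L>. if C \<subseteq> D then (-1) ^ card D * ((-1) ^ card C * of_bool (C \<inter> \<V> = {})) else 0)
      = (\<Sum>C\<in>Pow (D - \<V>). (-1) ^ card D * (-1 :: int) ^ card C)"
    proof (rule sum.mono_neutral_cong_right)
      show "Pow (D - \<V>) \<subseteq> set_chains \<L>"
        using set_chains_subset[OF D] by blast
      show "\<forall>C\<in>set_chains \<L> - Pow (D - \<V>).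
          (if C \<subseteq> D then (-1) ^ card D * ((-1) ^ card C * of_bool (C \<inter> \<V> = {})) else 0 :: int) = 0"
      proof
        fix C assume "C \<in> set_chains \<L> - Pow (D - \<V>)"
        then have "C \<subseteq> D \<Longrightarrow> C \<inter> \<V> \<noteq> {}" by blast
        then show "(if C \<subseteq> D then (-1) ^ card D * ((-1) ^ card C * of_bool (C \<inter> \<V> = {})) else 0 :: int) = 0"
          by simp
      qed
      fix C assume "C \<in> Pow (D - \<V>)"
      then have "C \<subseteq> D" "C \<inter> \<V> = {}" by blast+
      then show "(if C \<subseteq> D then (-1) ^ card D * ((-1) ^ card C * of_bool (C \<inter> \<V> = {})) else 0)
        = (-1) ^ card D * (-1 :: int) ^ card C" by simp
    qed (rule fin')
    also have "\<dots> = (-1) ^ card D * of_bool (D - \<V> = {})"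
      using sum_Pow_alternating[of "D - \<V>"] finD by (simp add: sum_distrib_left[symmetric])
    finally show "(\<Sum>C\<in>set_chains \<L>. if C \<subseteq> D then (-1) ^ card D * ((-1) ^ card C * of_bool (C \<inter> \<V> = {})) else 0)
      = (if D \<subseteq> \<V> then (-1) ^ card D else 0 :: int)" by (cases "D \<subseteq> \<V>") simp_all
  qed simp
  also have "\<dots> = (\<Sum>D\<in>{D\<in>set_chains \<L>. D \<subseteq> \<V>}. (-1) ^ card D)"
    using fin' by (simp add: sum.inter_filter)
  also have "{D\<in>set_chains \<L>. D \<subseteq> \<V>} = set_chains \<V>"
    using V unfolding set_chains_def by blast
  finally show ?thesis by (simp add: chain_sum_def)
qed

subsection \<open>Expansion in Schubert matroids\<close>

lemma ring_family_Pow: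
  assumes "matroid E \<B>"
  shows "submodular_ring_family E (Pow E) (mat_rank \<B>)"
  using assms mat_rank_submodular[OF assms]
  by unfold_locales (auto simp: matroid_def)

lemma ring_family_chain:
  assumes M: "matroid E \<B>" and C: "C \<in> set_chains (Pow E)"
  shows "submodular_ring_family E (insert E C) (mat_rank \<B>)"
proof -
  have chain: "F \<subseteq> G \<or> G \<subseteq> F" if "F \<in> insert E C" "G \<in> insert E C" for F G
    using C that unfolding set_chains_def chain_subset_def by blast
  show ?thesis
  proof
    show "finite E" using M by (simp add: matroid_def)
    show "F \<subseteq> E" if "F \<in> insert E C" for F using C that unfolding set_chains_def by blast
    show "F \<union> G \<in> insert E C" "F \<inter> G \<in> insert E C" if "F \<in> insert E C" "G \<in> insert E C" for F G
      using chain[OF that] that by (auto simp: Un_absorb1 Un_absorb2 Int_absorb1 Int_absorb2)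
  qed (simp_all add: mat_rank_submodular[OF M])
qed

text \<open>A set obeying all rank bounds obeys its own, so it is contained in a base; having the
  size of a base, it equals that base.\<close>

lemma bases_ring_family_Pow:
  assumes M: "matroid E \<B>"
  shows "submodular_ring_family.bases E (Pow E) (mat_rank \<B>) = \<B>"
proof -
  interpret submodular_ring_family E "Pow E" "mat_rank \<B>" using ring_family_Pow[OF M] .
  show ?thesis
  proof (intro equalityI subsetI)
    fix B assume B: "B \<in> bases"
    then have BE: "B \<subseteq> E" and card: "card B = mat_rank \<B> E" and "card (B \<inter> B) \<le> mat_rank \<B> B"
      unfolding bases_def by blast+
    moreover obtain B' where B': "B' \<in> \<B>" "card (B \<inter> B') = mat_rank \<B> B"
      using mat_rank_attained[OF M] by metis
    moreover have fin: "finite B" "finite B'"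
      using BE B' M unfolding matroid_def by (meson finite_subset)+
    ultimately have "card B \<le> card (B \<inter> B')" by simp
    then have "B \<inter> B' = B" using fin by (intro card_seteq) auto
    moreover have "card B' = card B" using matroid_card[OF M B'(1)] card by simp
    ultimately have "B = B'" using fin by (metis card_subset_eq inf.absorb_iff1)
    then show "B \<in> \<B>" using B' by simp
  next
    fix B assume B: "B \<in> \<B>"
    then show "B \<in> bases"
      using M matroid_card[OF M B] mat_rank_ge[OF M B]
      unfolding bases_def by (auto simp: matroid_def Int_commute)
  qed
qed

text \<open>The constraints common to a base polytope and all its chain relaxations, which then
  differ only in the rank inequalities imposed.\<close>

definition hypersimplex :: "'a set \<Rightarrow> nat \<Rightarrow> ('a \<Rightarrow>\<^sub>0 real) set"
  where "hypersimplex E r = {x \<in> supported_on E.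
    (\<forall>i. 0 \<le> Poly_Mapping.lookup x i \<and> Poly_Mapping.lookup x i \<le> 1) \<and> sum (Poly_Mapping.lookup x) E = r}"

definition violated_sets :: "'a set \<Rightarrow> 'a set set \<Rightarrow> ('a \<Rightarrow>\<^sub>0 real) \<Rightarrow> 'a set set"
  where "violated_sets E \<B> x = {F \<in> Pow E. mat_rank \<B> F < sum (Poly_Mapping.lookup x) F}"

definition chain_relaxation :: "'a set \<Rightarrow> 'a set set \<Rightarrow> 'a set set \<Rightarrow> 'a set set"
  where "chain_relaxation E \<B> C = submodular_ring_family.bases E (insert E C) (mat_rank \<B>)"

lemma mem_base_polytope:
  assumes M: "matroid E \<B>"
  shows "x \<in> base_polytope \<B> \<longleftrightarrow> x \<in> hypersimplex E (mat_rank \<B> E) \<and> violated_sets E \<B> x = {}"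
proof -
  interpret submodular_ring_family E "Pow E" "mat_rank \<B>" using ring_family_Pow[OF M] .
  have "base_polytope \<B> = polytope"
    using hull_bases unfolding base_polytope_def bases_ring_family_Pow[OF M] .
  then show ?thesis
    unfolding polytope_def hypersimplex_def violated_sets_def by (auto simp: not_less)
qed

lemma mem_base_polytope_chain_relaxation:
  assumes M: "matroid E \<B>" and C: "C \<in> set_chains (Pow E)"
  shows "x \<in> base_polytope (chain_relaxation E \<B> C) \<longleftrightarrow>
    x \<in> hypersimplex E (mat_rank \<B> E) \<and> C \<inter> violated_sets E \<B> x = {}"
proof -
  interpret submodular_ring_family E "insert E C" "mat_rank \<B>" using ring_family_chain[OF M C] .
  have "base_polytope (chain_relaxation E \<B> C) = polytope"
    using hull_bases unfolding base_polytope_def chain_relaxation_def .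
  moreover have "C \<inter> violated_sets E \<B> x = {} \<longleftrightarrow> (\<forall>F\<in>C. sum (Poly_Mapping.lookup x) F \<le> mat_rank \<B> F)"
    using C unfolding set_chains_def violated_sets_def by (fastforce simp: not_less[symmetric])
  ultimately show ?thesis
    unfolding polytope_def hypersimplex_def by auto
qed

text \<open>A base of \<open>\<M>\<close> remains a base when inequalities are dropped, so the
  relaxation is nonempty and has rank \<open>r\<close>. Its defining family is a chain, hence so are
  its cyclic flats.\<close>

lemma chain_relaxation_schubert:
  assumes M: "\<M> \<in> matroids r n" and C: "C \<in> set_chains (Pow {1..n})"
  shows "chain_relaxation {1..n} \<M> C \<in> schubert_matroids r n"
proof -
  have M': "matroid {1..n} \<M>" "mat_rank \<M> {1..n} = r" using M by (auto simp: matroids_def)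
  interpret submodular_ring_family "{1..n}" "insert {1..n} C" "mat_rank \<M>"
    using ring_family_chain[OF M'(1) C] .
  obtain B where B: "B \<in> \<M>" using M'(1) by (auto simp: matroid_def)
  have "card (B \<inter> F) \<le> mat_rank \<M> F" for F
    using mat_rank_ge[OF M'(1) B, of F] by (simp add: Int_commute)
  moreover have "B \<subseteq> {1..n}" using M'(1) B unfolding matroid_def by blast
  ultimately have "B \<in> bases"
    unfolding bases_def using matroid_card[OF M'(1) B] by blast
  then have mat: "matroid {1..n} bases" using matroid_bases by blast
  have "card B = r" using matroid_card[OF M'(1) B] M'(2) by simp
  then have "mat_rank bases {1..n} = r" using matroid_card[OF mat \<open>B \<in> bases\<close>] by simp
  moreover have "chain\<^sub>\<subseteq> (insert {1..n} C)"
    using C unfolding set_chains_def chain_subset_def by blast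
  ultimately show ?thesis
    using mat chain_cyclic_flats \<open>B \<in> bases\<close>
    unfolding schubert_matroids_def matroids_def chain_relaxation_def by blast
qed

text \<open>
  The excess \<open>x(F) - rk(F)\<close> is supermodular. If it is maximal at \<open>m\<close>, then it is at least as large
  at \<open>G \<inter> m\<close> as at \<open>G\<close>, which makes the violated sets conical.
\<close>

lemma chain_sum_violated_sets:
  assumes M: "matroid E \<B>"
  shows "chain_sum (violated_sets E \<B> x) = of_bool (violated_sets E \<B> x = {})"
proof (cases "violated_sets E \<B> x = {}")
  case False
  let ?V = "violated_sets E \<B> x"
  define g where "g F = sum (Poly_Mapping.lookup x) F - real (mat_rank \<B> F)" for F
  have finE: "finite E" using M by (simp add: matroid_def)
  have V: "F \<in> ?V \<longleftrightarrow> F \<subseteq> E \<and> 0 < g F" for F unfolding violated_sets_def g_def by auto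
  have finV: "finite ?V" unfolding violated_sets_def using finE by simp
  have super: "g F + g G \<le> g (F \<union> G) + g (F \<inter> G)" if "F \<subseteq> E" "G \<subseteq> E" for F G
  proof -
    have "finite F" "finite G" using that finE finite_subset by blast+
    then have "sum (Poly_Mapping.lookup x) (F \<union> G) + sum (Poly_Mapping.lookup x) (F \<inter> G)
      = sum (Poly_Mapping.lookup x) F + sum (Poly_Mapping.lookup x) G" by (rule sum.union_inter)
    then show ?thesis using mat_rank_submodular[OF M, of F G] unfolding g_def by linarith
  qed
  have "Max (g ` ?V) \<in> g ` ?V" using finV False by simp
  then obtain m where m: "m \<in> ?V" "g m = Max (g ` ?V)" by force
  have max: "g G \<le> g m" if "G \<in> ?V" for G using that finV m by simp
  have "G \<inter> m \<in> ?V" if G: "G \<in> ?V" for G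
  proof -
    have sub: "G \<subseteq> E" "m \<subseteq> E" and pos: "0 < g G" "0 < g m" using G m(1) V by blast+
    \<comment> \<open>Either \<open>G \<union> m\<close> is violated and maximality of
      \<open>m\<close> applies, or its excess is at most 0.\<close>
    have "g (G \<union> m) \<le> g m"
      using max[of "G \<union> m"] V[of "G \<union> m"] sub pos by force
    then have "0 < g (G \<inter> m)" using super[OF sub] pos by linarith
    then show ?thesis using V sub by blast
  qed
  then show ?thesis using chain_sum_conical[OF finV m(1)] False by simp
qed simp

section \<open>Existence of the expansion\<close>

lemma finite_matroids: "finite (matroids r n)"
proof (rule finite_subset)
  show "matroids r n \<subseteq> Pow (Pow {1..n})" by (auto simp: matroids_def matroid_def)
qed simp

lemma finite_schubert_matroids: "finite (schubert_matroids r n)"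
  unfolding schubert_matroids_def using finite_matroids by simp

lemma schubert_expansion_exists:
  assumes M: "\<M> \<in> matroids r n"
  shows "\<exists>a. schubert_expansion r n \<M> a"
proof -
  let ?L = "Pow {1..n}"
  have M': "matroid {1..n} \<M>" using M by (auto simp: matroids_def)
  \<comment> \<open>Different chains may yield the same Schubert matroid, so their coefficients are
    added up.\<close>
  define a where "a \<S> = (\<Sum>C\<in>{C\<in>set_chains ?L. chain_relaxation {1..n} \<M> C = \<S>}. chain_coeff ?L C)" for \<S>
  have fin: "finite (set_chains ?L)" by (simp add: finite_set_chains)
  have "indicator (base_polytope \<M>) x = (\<Sum>\<S>\<in>schubert_matroids r n. a \<S> * indicator (base_polytope \<S>) x)" for x
  proof -
    let ?V = "violated_sets {1..n} \<M> x"
    let ?H = "of_bool (x \<in> hypersimplex {1..n} (mat_rank \<M> {1..n})) :: int"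
    have "(\<Sum>\<S>\<in>schubert_matroids r n. a \<S> * indicator (base_polytope \<S>) x)
      = (\<Sum>\<S>\<in>schubert_matroids r n. \<Sum>C\<in>{C\<in>set_chains ?L. chain_relaxation {1..n} \<M> C = \<S>}.
          chain_coeff ?L C * indicator (base_polytope (chain_relaxation {1..n} \<M> C)) x)"
      unfolding a_def sum_distrib_right by (intro sum.cong refl) auto
    also have "\<dots> = (\<Sum>C\<in>set_chains ?L. chain_coeff ?L C * indicator (base_polytope (chain_relaxation {1..n} \<M> C)) x)"
      using chain_relaxation_schubert[OF M]
      by (intro sum.group fin finite_schubert_matroids) blast
    also have "\<dots> = (\<Sum>C\<in>set_chains ?L. ?H * (chain_coeff ?L C * of_bool (C \<inter> ?V = {})))"
      by (intro sum.cong refl)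
        (simp add: indicator_def mem_base_polytope_chain_relaxation[OF M'] of_bool_conj del: One_nat_def)
    also have "\<dots> = ?H * chain_sum ?V"
      unfolding sum_distrib_left[symmetric]
      by (subst sum_chain_coeff) (auto simp: violated_sets_def)
    also have "\<dots> = indicator (base_polytope \<M>) x"
      using chain_sum_violated_sets[OF M', of x]
      by (simp add: indicator_def mem_base_polytope[OF M'] of_bool_conj del: One_nat_def)
    finally show ?thesis by simp
  qed
  then show ?thesis unfolding schubert_expansion_def by blast
qed

lemma schubert_expansion_coeff:
  "\<M> \<in> matroids r n \<Longrightarrow> schubert_expansion r n \<M> (schubert_coeff r n \<M>)"
  unfolding schubert_coeff_def using schubert_expansion_exists by (rule someI_ex)

subsection \<open>Integer points\<close>

definition evaluate :: "nat \<Rightarrow> nat \<Rightarrow> (nat \<Rightarrow>\<^sub>0 real) \<Rightarrow> (nat set set \<Rightarrow>\<^sub>0 real) \<Rightarrow> real"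
  where "evaluate r n x p =
    (\<Sum>\<S>\<in>schubert_matroids r n. Poly_Mapping.lookup p \<S> * indicator (base_polytope \<S>) x)"

lemma evaluate_sum: "evaluate r n x (\<Sum>i\<in>I. u i *\<^sub>R p i) = (\<Sum>i\<in>I. u i * evaluate r n x (p i))"
proof -
  have "evaluate r n x (\<Sum>i\<in>I. u i *\<^sub>R p i) = (\<Sum>\<S>\<in>schubert_matroids r n. \<Sum>i\<in>I.
      u i * (Poly_Mapping.lookup (p i) \<S> * indicator (base_polytope \<S>) x))"
    by (simp add: evaluate_def lookup_sum sum_distrib_right mult.assoc)
  also have "\<dots> = (\<Sum>i\<in>I. u i * evaluate r n x (p i))"
    unfolding evaluate_def sum_distrib_left by (rule sum.swap)
  finally show ?thesis .
qed

lemma evaluate_integer: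
  assumes "p \<in> integer_points (schubert_matroids r n)"
  shows "evaluate r n x p \<in> \<int>"
  unfolding evaluate_def
  by (intro Ints_sum Ints_mult) (use assms in \<open>auto simp: integer_points_def indicator_def\<close>)

lemma evaluate_matroid_point:
  assumes "\<M> \<in> matroids r n" "x \<in> supported_on {1..n}"
  shows "evaluate r n x (matroid_point r n \<M>) = indicator (base_polytope \<M>) x"
proof -
  have "evaluate r n x (matroid_point r n \<M>)
    = of_int (\<Sum>\<S>\<in>schubert_matroids r n. schubert_coeff r n \<M> \<S> * indicator (base_polytope \<S>) x)"
    unfolding evaluate_def matroid_point_def
    by (simp add: lookup_vec_on finite_schubert_matroids indicator_def)
  also have "\<dots> = of_int (indicator (base_polytope \<M>) x)"
    using schubert_expansion_coeff[OF assms(1)] assms(2) unfolding schubert_expansion_def by simp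
  finally show ?thesis by (simp add: indicator_def)
qed

lemma matroid_point_integer: "matroid_point r n \<M> \<in> integer_points (schubert_matroids r n)"
  by (auto simp: integer_points_def matroid_point_def mem_supported_on lookup_vec_on finite_schubert_matroids)

section \<open>Recovering a matroid from its polytope and its point\<close>

lemma base_polytope_supported:
  "\<M> \<in> matroids r n \<Longrightarrow> x \<in> base_polytope \<M> \<Longrightarrow> x \<in> supported_on {1..n}"
  using mem_base_polytope unfolding matroids_def hypersimplex_def by blast

text \<open>The 0/1 points of a base polytope are exactly the indicator vectors of its
  bases.\<close>

lemma base_polytope_mono_imp_subset:
  assumes "\<M> \<in> matroids r n" "\<N> \<in> matroids r n" "base_polytope \<M> \<subseteq> base_polytope \<N>"
  shows "\<M> \<subseteq> \<N>"
proof
  fix B assume B: "B \<in> \<M>"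
  have N: "matroid {1..n} \<N>" and BE: "B \<subseteq> {1..n}"
    using assms B by (auto simp: matroids_def matroid_def)
  then have "finite B" using finite_subset by blast
  interpret submodular_ring_family "{1..n}" "Pow {1..n}" "mat_rank \<N>" using ring_family_Pow[OF N] .
  have "vec_on B (\<lambda>_. 1) \<in> base_polytope \<M>"
    unfolding base_polytope_def using B by (simp add: hull_inc)
  then have "vec_on B (\<lambda>_. 1) \<in> polytope"
    using assms(3) hull_bases unfolding base_polytope_def bases_ring_family_Pow[OF N] by blast
  then show "B \<in> \<N>"
    using mem_bases_if_vec_on_mem_polytope[OF \<open>finite B\<close>] bases_ring_family_Pow[OF N] by simp
qed

text \<open>Evaluating the point everywhere returns the indicator of the base polytope, which
  determines the matroid.\<close>

lemma matroid_point_inj: "inj_on (matroid_point r n) (matroids r n)"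
proof (rule inj_onI)
  fix \<M> \<N> assume M: "\<M> \<in> matroids r n" and N: "\<N> \<in> matroids r n"
    and eq: "matroid_point r n \<M> = matroid_point r n \<N>"
  have "x \<in> base_polytope \<M> \<longleftrightarrow> x \<in> base_polytope \<N>" if "x \<in> supported_on {1..n}" for x
    using evaluate_matroid_point[OF M that] evaluate_matroid_point[OF N that] eq
    by (auto simp: indicator_def split: if_splits)
  then have "base_polytope \<M> = base_polytope \<N>" using base_polytope_supported M N by blast
  then show "\<M> = \<N>" using base_polytope_mono_imp_subset M N by (metis order_antisym order_refl)
qed

text \<open>Injectivity lets the weights be indexed by matroids instead of points.\<close>

lemma polytope_of_matroids_weights:
  assumes "p \<in> polytope_of_matroids r n"
  obtains u where "\<And>\<M>. \<M> \<in> matroids r n \<Longrightarrow> 0 \<le> u \<M>" "sum u (matroids r n) = (1 :: real)"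
    "p = (\<Sum>\<M>\<in>matroids r n. u \<M> *\<^sub>R matroid_point r n \<M>)"
proof -
  obtain v where "\<forall>q\<in>matroid_point r n ` matroids r n. 0 \<le> v q"
    "sum v (matroid_point r n ` matroids r n) = 1"
    "p = (\<Sum>q\<in>matroid_point r n ` matroids r n. v q *\<^sub>R q)"
    using assms unfolding polytope_of_matroids_def convex_hull_finite[OF finite_imageI[OF finite_matroids]]
    by blast
  then show ?thesis
    using that[of "v \<circ> matroid_point r n"] by (simp add: sum.reindex matroid_point_inj)
qed

text \<open>
  For an integer point, the function \<open>x \<mapsto> evaluate r n x p = (\<Sum>\<M>. u \<M> * indicator (base_polytope \<M>) x)\<close>
  only takes the values 0 and 1, so all matroids of positive weight have the same base polytope.
\<close>

lemma integer_point_weights: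
  assumes u: "\<And>\<M>. \<M> \<in> matroids r n \<Longrightarrow> 0 \<le> u \<M>" "sum u (matroids r n) = (1 :: real)"
    and p: "(\<Sum>\<M>\<in>matroids r n. u \<M> *\<^sub>R matroid_point r n \<M>) \<in> integer_points (schubert_matroids r n)"
  obtains \<N> where "\<N> \<in> matroids r n" "\<And>\<M>. \<M> \<in> matroids r n \<Longrightarrow> \<M> \<noteq> \<N> \<Longrightarrow> u \<M> = 0"
proof -
  let ?p = "\<Sum>\<M>\<in>matroids r n. u \<M> *\<^sub>R matroid_point r n \<M>"
  have sub: "base_polytope \<M> \<subseteq> base_polytope \<N>"
    if M: "\<M> \<in> matroids r n" "0 < u \<M>" and N: "\<N> \<in> matroids r n" "0 < u \<N>" for \<M> \<N>
  proof
    fix x assume x: "x \<in> base_polytope \<M>"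
    then have sx: "x \<in> supported_on {1..n}" using base_polytope_supported M by blast
    have eq: "evaluate r n x ?p = (\<Sum>\<M>\<in>matroids r n. u \<M> * indicator (base_polytope \<M>) x)"
      unfolding evaluate_sum by (intro sum.cong refl) (simp add: evaluate_matroid_point sx del: One_nat_def)
    have "u \<M> * indicator (base_polytope \<M>) x \<le> evaluate r n x ?p"
      unfolding eq by (rule member_le_sum) (use M u finite_matroids in auto)
    then have pos: "0 < evaluate r n x ?p" using M x by simp
    show "x \<in> base_polytope \<N>"
    proof (rule ccontr)
      assume "x \<notin> base_polytope \<N>"
      \<comment> \<open>The matroid \<open>\<N>\<close> has positive weight but contributes 0 at
        \<open>x\<close>, so the value drops strictly below 1. Being a positive integer, it
        cannot.\<close>
      then have "evaluate r n x ?p < sum u (matroids r n)"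
        unfolding eq using u N
        by (intro sum_strict_mono_ex1 finite_matroids) (auto simp: indicator_def)
      then show False
        using pos u(2) evaluate_integer[OF p, of x] by (auto elim!: Ints_cases)
    qed
  qed
  have "\<exists>\<N>\<in>matroids r n. 0 < u \<N>"
    using u by (metis less_eq_real_def sum.neutral zero_neq_one)
  then obtain \<N> where N: "\<N> \<in> matroids r n" "0 < u \<N>" by blast
  have "u \<M> = 0" if M: "\<M> \<in> matroids r n" "\<M> \<noteq> \<N>" for \<M>
  proof (rule ccontr)
    assume "u \<M> \<noteq> 0"
    then have "0 < u \<M>" using u(1)[OF M(1)] by simp
    then have "\<M> = \<N>"
      using sub N M base_polytope_mono_imp_subset by (metis order_antisym)
    then show False using M by simp
  qed
  then show ?thesis using that N by blast
qed

lemma sum_concentrated: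
  fixes f :: "'a \<Rightarrow> 'b::real_vector"
  assumes "finite A" "a \<in> A" "\<And>b. b \<in> A \<Longrightarrow> b \<noteq> a \<Longrightarrow> u b = 0" "sum u A = (1 :: real)"
  shows "(\<Sum>b\<in>A. u b *\<^sub>R f b) = f a"
proof -
  have "(\<Sum>b\<in>A. u b *\<^sub>R f b) = u a *\<^sub>R f a"
    by (subst sum.remove[OF assms(1,2)]) (use assms(3) in \<open>auto intro!: sum.neutral\<close>)
  moreover have "sum u A = u a"
    by (subst sum.remove[OF assms(1,2)]) (use assms(3) in \<open>auto intro!: sum.neutral\<close>)
  ultimately show ?thesis using assms(4) by simp
qed

text \<open>If \<open>p\<close> lay inside a segment from \<open>a\<close> to \<open>b\<close>,
  mixing their weights would give weights for \<open>p\<close>, which are concentrated on a single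
  matroid. Nonnegativity concentrates the weights of \<open>a\<close> and \<open>b\<close> on the
  same matroid, so \<open>a = b\<close>.\<close>

lemma integer_point_extreme:
  assumes p: "p \<in> polytope_of_matroids r n" "p \<in> integer_points (schubert_matroids r n)"
  shows "p extreme_point_of polytope_of_matroids r n"
  unfolding extreme_point_of_def
proof (intro conjI ballI notI)
  fix a b assume a: "a \<in> polytope_of_matroids r n" and b: "b \<in> polytope_of_matroids r n"
    and "p \<in> open_segment a b"
  then obtain t where t: "0 < t" "t < 1" "p = (1 - t) *\<^sub>R a + t *\<^sub>R b" and "a \<noteq> b"
    unfolding in_segment by blast
  let ?M = "matroids r n" and ?q = "matroid_point r n"
  obtain u where u: "\<And>\<M>. \<M> \<in> ?M \<Longrightarrow> 0 \<le> u \<M>" "sum u ?M = (1 :: real)" "a = (\<Sum>\<M>\<in>?M. u \<M> *\<^sub>R ?q \<M>)"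
    using polytope_of_matroids_weights[OF a] by metis
  obtain v where v: "\<And>\<M>. \<M> \<in> ?M \<Longrightarrow> 0 \<le> v \<M>" "sum v ?M = (1 :: real)" "b = (\<Sum>\<M>\<in>?M. v \<M> *\<^sub>R ?q \<M>)"
    using polytope_of_matroids_weights[OF b] by metis
  define w where "w \<M> = (1 - t) * u \<M> + t * v \<M>" for \<M>
  have "p = (\<Sum>\<M>\<in>?M. w \<M> *\<^sub>R ?q \<M>)"
    unfolding t(3) u(3) v(3) w_def
    by (simp add: scaleR_sum_right sum.distrib scaleR_add_left)
  then have w_int: "(\<Sum>\<M>\<in>?M. w \<M> *\<^sub>R ?q \<M>) \<in> integer_points (schubert_matroids r n)"
    using p(2) by (rule subst)
  have w_nonneg: "0 \<le> w \<M>" if "\<M> \<in> ?M" for \<M>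
    using u(1)[OF that] v(1)[OF that] t by (simp add: w_def)
  have w_sum: "sum w ?M = 1"
    unfolding w_def by (simp add: sum.distrib sum_distrib_left[symmetric] u(2) v(2))
  obtain \<N> where N: "\<N> \<in> ?M" "\<And>\<M>. \<M> \<in> ?M \<Longrightarrow> \<M> \<noteq> \<N> \<Longrightarrow> w \<M> = 0"
    using integer_point_weights[OF w_nonneg w_sum w_int] by blast
  have "u \<M> = 0 \<and> v \<M> = 0" if M: "\<M> \<in> ?M" "\<M> \<noteq> \<N>" for \<M>
  proof -
    have "0 \<le> (1 - t) * u \<M>" "0 \<le> t * v \<M>" using u(1) v(1) M t by simp_all
    then have "(1 - t) * u \<M> = 0 \<and> t * v \<M> = 0"
      using N(2)[OF M] unfolding w_def by linarith
    then show ?thesis using t by simp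
  qed
  then have "a = ?q \<N>" "b = ?q \<N>"
    unfolding u(3) v(3) using sum_concentrated[OF finite_matroids N(1)] u(2) v(2) by blast+
  then show False using \<open>a \<noteq> b\<close> by simp
qed (rule p(1))

theorem theorem3p7:
  fixes r n :: nat
  assumes "r \<le> n"
  shows "polytope_of_matroids r n \<inter> integer_points (schubert_matroids r n)
       = {p. p extreme_point_of polytope_of_matroids r n}"
proof (intro equalityI subsetI)
  fix p assume "p \<in> {p. p extreme_point_of polytope_of_matroids r n}"
  then have p: "p extreme_point_of polytope_of_matroids r n" by simp
  \<comment> \<open>Extreme points of a convex hull are among its generators, here integer
    vectors.\<close>
  then have "p \<in> matroid_point r n ` matroids r n"
    unfolding polytope_of_matroids_def by (rule extreme_point_of_convex_hull)
  then show "p \<in> polytope_of_matroids r n \<inter> integer_points (schubert_matroids r n)"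
    using p matroid_point_integer unfolding extreme_point_of_def by blast
qed (simp add: integer_point_extreme)

end
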